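(* Let $\mathcal{F}_3$ be the set of triples of non-negative integers, identified up to permutation, satisfying $(x_1+x_2+x_3)^2-(x_1+x_2+x_3)-4(x_1x_2+x_1x_3+x_2x_3)=0$ (the 3-color fair games), with two elements adjacent if (for suitable orderings) they differ in exactly one coordinate. Call a game non-trivial if $x_1+x_2+x_3\ge 2$. Then the induced graph on the non-trivial 3-color fair games is an infinite full binary tree with root $(0,1,3)$: it is a tree, every vertex has exactly two children, where the children of a vertex are its neighbors of greater height $\left|1+x_1+x_2+x_3\right|$, and every vertex other than $(0,1,3)$ has exactly one neighbor of smaller height while $(0,1,3)$ has none in this graph. *)

theory Defs
  imports "HOL-Library.Multiset" "Graph_Theory.Graph_Theory"
begin

text \<open>
  Triples up to permutation are multisets of size three. The entries are integers, constrained to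
  be non-negative, so that the subtractions in the defining equation are not truncated.
\<close>

definition fair_games :: "int multiset set" where
  "fair_games = {{#x1, x2, x3#} | x1 x2 x3.
     0 \<le> x1 \<and> 0 \<le> x2 \<and> 0 \<le> x3 \<and>
     (x1 + x2 + x3)^2 - (x1 + x2 + x3) - 4 * (x1 * x2 + x1 * x3 + x2 * x3) = 0}"

text \<open>
  Two multisets of size three have orderings that differ in exactly one coordinate iff they share
  two entries (with multiplicity) and the remaining entries are different.
\<close>

definition adjacent_games :: "int multiset \<Rightarrow> int multiset \<Rightarrow> bool" where
  "adjacent_games M N \<longleftrightarrow>
     (\<exists>a b c d. M = {#a, b, c#} \<and> N = {#a, b, d#} \<and> c \<noteq> d)"

text \<open>
  Undirected graphs are represented as symmetric digraphs: an edge between two vertices is a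
  pair of opposite arcs.
\<close>

definition fair_game_graph :: "(int multiset, int multiset \<times> int multiset) pre_digraph" where
  "fair_game_graph = with_proj
     \<lparr>pverts = fair_games,
      parcs = {(M, N). M \<in> fair_games \<and> N \<in> fair_games \<and> adjacent_games M N}\<rparr>"

definition nontrivial_games :: "int multiset set" where
  "nontrivial_games = {M \<in> fair_games. sum_mset M \<ge> 2}"

definition nontrivial_game_graph :: "(int multiset, int multiset \<times> int multiset) pre_digraph" where
  "nontrivial_game_graph = fair_game_graph \<restriction> nontrivial_games"

definition height :: "int multiset \<Rightarrow> int" where
  "height M = \<bar>1 + sum_mset M\<bar>"

definition children :: "int multiset \<Rightarrow> int multiset set" where
  "children M = {N. M \<rightarrow>\<^bsub>nontrivial_game_graph\<^esub> N \<and> height M < height N}"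

definition parents :: "int multiset \<Rightarrow> int multiset set" where
  "parents M = {N. M \<rightarrow>\<^bsub>nontrivial_game_graph\<^esub> N \<and> height N < height M}"

text \<open>
  The predicate \<^const>\<open>tree\<close> forbids all directed cycles, hence is false for every symmetric digraph
  that has an arc: traversing an edge back and forth is a directed cycle. In a symmetric digraph
  without loops and parallel arcs, the cycles of the underlying simple graph are exactly the
  directed cycles of length at least three.
\<close>

definition undirected_tree :: "('a, 'b) pre_digraph \<Rightarrow> bool" where
  "undirected_tree G \<longleftrightarrow>
     connected G \<and> \<not> (\<exists>p. pre_digraph.cycle G p \<and> length p \<ge> 3)"

end

theory Submission
  imports Defs
begin

text \<open>
  With two coordinates a, b fixed, the defining equation is quadratic in the third one, and its two
  roots sum to 2(a + b) + 1; so every coordinate can be replaced in exactly one way. In a non-trivial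
  game the coordinates are distinct, and the largest one exceeds the sum of the other two. Replacing
  it therefore lowers the height, and replacing either of the others raises it. Descending along
  the unique parents reaches the root, and a vertex of maximal height on a cycle would have two
  distinct parents.
\<close>

section \<open>Ordered triples and their multisets\<close>

definition fair :: "int \<Rightarrow> int \<Rightarrow> int \<Rightarrow> bool" where
  "fair a b c \<longleftrightarrow> 0 \<le> a \<and> 0 \<le> b \<and> 0 \<le> c \<and>
     (a + b + c)^2 - (a + b + c) - 4 * (a * b + a * c + b * c) = 0"

lemma fair_swap12: "fair a b c \<longleftrightarrow> fair b a c"
  and fair_swap23: "fair a b c \<longleftrightarrow> fair a c b"
  by (auto simp: fair_def algebra_simps power2_eq_square)

lemma mset2_eq_iff:
  "{#a, b#} = {#x, y#} \<longleftrightarrow> a = x \<and> b = y \<or> a = y \<and> b = x"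
  by (auto simp: add_eq_conv_diff)

text \<open>The six orderings are listed explicitly so that automation can split an equation between
  games into equations between coordinates.\<close>

lemma mset3_eq_iff:
  "{#a, b, c#} = {#x, y, z#} \<longleftrightarrow>
     (a, b, c) \<in> {(x, y, z), (x, z, y), (y, x, z), (y, z, x), (z, x, y), (z, y, x)}"
proof
  assume eq: "{#a, b, c#} = {#x, y, z#}"
  then have "a \<in> {x, y, z}" by (metis set_mset_add_mset_insert set_mset_empty insertI1)
  then consider "a = x" | "a = y" | "a = z" by blast
  then show "(a, b, c) \<in> {(x, y, z), (x, z, y), (y, x, z), (y, z, x), (z, x, y), (z, y, x)}"
  proof cases
    case 1
    then show ?thesis using eq mset2_eq_iff[of b c y z] by auto
  next
    case 2
    then show ?thesis using eq mset2_eq_iff[of b c x z] by (auto simp: add_mset_commute[of x y])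
  next
    case 3
    then have "add_mset z {#b, c#} = add_mset z {#x, y#}" using eq by (simp add: add_mset_commute)
    then show ?thesis using 3 mset2_eq_iff[of b c x y] by auto
  qed
qed (auto simp: add_mset_commute)

lemma mset3_in_fair_games: "{#a, b, c#} \<in> fair_games \<longleftrightarrow> fair a b c"
proof
  assume "{#a, b, c#} \<in> fair_games"
  then obtain x y z where "{#a, b, c#} = {#x, y, z#}" "fair x y z"
    by (auto simp: fair_games_def fair_def)
  then show "fair a b c"
    unfolding mset3_eq_iff by (auto dest: fair_swap12[THEN iffD1] fair_swap23[THEN iffD1])
qed (auto simp: fair_games_def fair_def)

lemma fair_games_cases:
  assumes "M \<in> fair_games"
  obtains a b c where "M = {#a, b, c#}" "fair a b c"
proof -
  obtain a b c where "M = {#a, b, c#}" using assms by (auto simp: fair_games_def)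
  with assms that show ?thesis by (simp add: mset3_in_fair_games)
qed

lemma mset3_sorted_cases:
  obtains x y z :: "'a::linorder" where "{#a, b, c#} = {#x, y, z#}" "x \<le> y" "y \<le> z"
proof -
  have "\<exists>x y z. {#a, b, c#} = {#x, y, z#} \<and> x \<le> y \<and> y \<le> z"
    unfolding mset3_eq_iff by (smt (verit) insertCI linear)
  then show ?thesis using that by blast
qed

section \<open>The quadratic in a single coordinate\<close>

lemma fair_flip:
  assumes "fair a b c"
  shows "fair a b (2 * (a + b) + 1 - c)"
proof -
  define d where "d = 2 * (a + b) + 1 - c"
  have eq: "(a + b + d)^2 - (a + b + d) - 4 * (a * b + a * d + b * d) = 0"
    using assms by (simp add: fair_def d_def algebra_simps power2_eq_square)
  have ab: "0 \<le> a" "0 \<le> b" using assms by (simp_all add: fair_def)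
  \<comment> \<open>The real content is that the second root stays non-negative: if
    \<open>d \<le> - 1\<close>, the equation would equate the positive number
    \<open>(a - b)^2 + (d^2 - d)\<close> with \<open>(a + b) * (1 + 2 * d)\<close>, which is at most
    \<open>- (a + b)\<close>.\<close>
  have "0 \<le> d"
  proof (rule ccontr)
    assume neg: "\<not> 0 \<le> d"
    have "(a - b)^2 + (d^2 - d) = (a + b) + 2 * (a + b) * d"
      using eq by (simp add: algebra_simps power2_eq_square)
    moreover have "2 * (a + b) * d \<le> 2 * (a + b) * (- 1)"
      using neg ab by (intro mult_left_mono) auto
    moreover have "0 < (a - b)^2 + (d^2 - d)"
      using neg by (intro add_nonneg_pos) (auto intro: less_le_trans[of d 0])
    ultimately show False using ab by simp
  qed
  with eq ab show ?thesis by (simp add: fair_def d_def)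
qed

text \<open>Subtracting the two equations leaves a product with factor \<open>c - d\<close>; the
  cofactor must vanish, which is Vieta's formula for the sum of the roots.\<close>

lemma fair_unique:
  assumes "fair a b c" "fair a b d" "c \<noteq> d"
  shows "d = 2 * (a + b) + 1 - c"
proof -
  have "(c - d) * (c + d - (2 * (a + b) + 1)) = 0"
    using assms by (simp add: fair_def algebra_simps power2_eq_square)
  then show ?thesis using assms(3) by simp
qed

text \<open>The equation becomes \<open>c * (c - 1) = 2 * a * (2 * c + 1)\<close>. Dividing
  \<open>4 * (c * (c - 1))\<close> by \<open>2 * c + 1\<close> leaves remainder 3, so
  \<open>2 * c + 1\<close> divides 3. Hence \<open>c\<close> is 0 or 1, the left side is 0, and so
  \<open>a = 0\<close>.\<close>

lemma fair_repeated:
  assumes "fair a a c"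
  shows "a + a + c < 2"
proof -
  have nonneg: "0 \<le> a" "0 \<le> c" and eq: "c * (c - 1) = 2 * a * (2 * c + 1)"
    using assms by (auto simp: fair_def algebra_simps power2_eq_square)
  have "3 = 4 * (c * (c - 1)) - (2 * c + 1) * (2 * c - 3)"
    by (simp add: algebra_simps)
  also have "\<dots> = (2 * c + 1) * (8 * a - (2 * c - 3))"
    unfolding eq by (simp add: algebra_simps)
  finally have "2 * c + 1 dvd 3" by (metis dvd_triv_left)
  then have "2 * c + 1 \<le> 3" by (rule zdvd_imp_le) simp
  then have "c = 0 \<or> c = 1" using nonneg by auto
  then show ?thesis using eq by auto
qed

lemma fair_largest:
  assumes "fair a b c" "a < b" "b < c"
  shows "a + b < c"
proof (rule ccontr)
  assume "\<not> a + b < c"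
  text \<open>Otherwise b lies below both roots, where the quadratic is positive; but at b it is negative.\<close>
  then have "0 \<le> (c - b) * (2 * (a + b) + 1 - c - b)"
    using assms by (intro mult_nonneg_nonneg) (auto simp: fair_def)
  also have "\<dots> = (a + b + b)^2 - (a + b + b) - 4 * (a * b + a * b + b * b)"
    using assms(1) by (simp add: fair_def algebra_simps power2_eq_square)
  also have "\<dots> = a * (a - b) - 3 * (a * b) - a - 2 * b"
    by (simp add: algebra_simps power2_eq_square)
  also have "\<dots> < 0"
  proof -
    have "0 \<le> a * b" "a * (a - b) \<le> 0"
      using assms by (auto simp: fair_def intro: mult_nonneg_nonpos)
    then show ?thesis using assms by (simp only: fair_def) linarith
  qed
  finally show False by simp
qed

section \<open>Normal form of non-trivial games\<close>

lemma mset3_in_nontrivial_games: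
  "{#a, b, c#} \<in> nontrivial_games \<longleftrightarrow> fair a b c \<and> 2 \<le> a + b + c"
  by (simp add: nontrivial_games_def mset3_in_fair_games add.assoc)

text \<open>Sort the entries: \<open>fair_repeated\<close> makes the order strict and
  \<open>fair_largest\<close> yields the gap \<open>a + b < c\<close>, which later decides the
  direction of each replacement.\<close>

lemma nontrivial_games_cases:
  assumes "M \<in> nontrivial_games"
  obtains a b c where "M = {#a, b, c#}" "fair a b c" "0 \<le> a" "a < b" "a + b < c"
proof -
  obtain x y z where xyz: "M = {#x, y, z#}" "fair x y z"
    using assms by (auto simp: nontrivial_games_def elim: fair_games_cases)
  obtain a b c where abc: "M = {#a, b, c#}" "a \<le> b" "b \<le> c"
    using mset3_sorted_cases xyz(1) by metis
  then have f: "fair a b c" and s: "2 \<le> a + b + c"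
    using assms mset3_in_nontrivial_games by auto
  have "a \<noteq> b" using fair_repeated f s by fastforce
  moreover have "b \<noteq> c" 
    using fair_repeated[of b a] f s fair_swap12[of a b b] fair_swap23[of b a b] by auto
  ultimately have "a < b" "b < c" using abc by auto
  then show ?thesis using that abc(1) f fair_largest by (auto simp: fair_def)
qed

section \<open>Adjacency in the graph\<close>

lemma verts_nontrivial: "verts nontrivial_game_graph = nontrivial_games"
  by (simp add: nontrivial_game_graph_def)

lemma dominates_iff:
  "M \<rightarrow>\<^bsub>nontrivial_game_graph\<^esub> N \<longleftrightarrow>
     M \<in> nontrivial_games \<and> N \<in> nontrivial_games \<and> adjacent_games M N"
  by (auto simp: nontrivial_game_graph_def fair_game_graph_def arcs_ends_conv
      induce_subgraph_def nontrivial_games_def)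

lemma sym_digraph_nontrivial: "sym_digraph nontrivial_game_graph"
proof -
  have "wf_digraph nontrivial_game_graph"
    by unfold_locales (auto simp: nontrivial_game_graph_def fair_game_graph_def induce_subgraph_def)
  moreover have "symmetric nontrivial_game_graph"
    unfolding symmetric_def sym_def dominates_iff adjacent_games_def by metis
  ultimately show ?thesis by (simp add: sym_digraph_def sym_digraph_axioms_def)
qed

text \<open>By \<open>fair_unique\<close>, a neighbor arises by exchanging one coordinate for the
  other root. Membership of \<open>N\<close> stays as a condition because an exchange can leave the
  non-trivial games: at the root, replacing 3 gives \<open>{#0, 1, 0#}\<close>.\<close>

lemma dominates_mset3_iff:
  assumes "{#a, b, c#} \<in> nontrivial_games"
  shows "{#a, b, c#} \<rightarrow>\<^bsub>nontrivial_game_graph\<^esub> N \<longleftrightarrow> N \<in> nontrivial_games \<and>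
    N \<in> {{#b, c, 2 * (b + c) + 1 - a#}, {#a, c, 2 * (a + c) + 1 - b#}, {#a, b, 2 * (a + b) + 1 - c#}}"
    (is "_ \<longleftrightarrow> _ \<and> N \<in> ?F")
proof (intro iffI conjI; (elim conjE)?)
  assume *: "{#a, b, c#} \<rightarrow>\<^bsub>nontrivial_game_graph\<^esub> N"
  then show "N \<in> nontrivial_games" by (simp add: dominates_iff)
  obtain x y z d where eq: "{#a, b, c#} = {#x, y, z#}" and N: "N = {#x, y, d#}" and "z \<noteq> d"
    using * by (auto simp: dominates_iff adjacent_games_def)
  moreover have "fair x y z" using assms eq by (simp add: mset3_in_nontrivial_games)
  moreover have "fair x y d"
    using * N by (simp add: dominates_iff mset3_in_nontrivial_games)
  ultimately have "N = {#x, y, 2 * (x + y) + 1 - z#}" using fair_unique by blast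
  with eq show "N \<in> ?F"
    unfolding mset3_eq_iff by (auto simp: add_mset_commute add.commute)
next
  assume N: "N \<in> nontrivial_games" "N \<in> ?F"
  have flip: "{#x, y, z#} \<rightarrow>\<^bsub>nontrivial_game_graph\<^esub> N"
    if "N = {#x, y, 2 * (x + y) + 1 - z#}" "{#x, y, z#} = {#a, b, c#}" for x y z
  proof -
    \<comment> \<open>Parity: equality would make \<open>2 * z\<close> odd.\<close>
    have "z \<noteq> 2 * (x + y) + 1 - z" by presburger
    then have "adjacent_games {#x, y, z#} N" using that(1) by (auto simp only: adjacent_games_def)
    with that(2) N(1) assms show ?thesis by (simp add: dominates_iff)
  qed
  show "{#a, b, c#} \<rightarrow>\<^bsub>nontrivial_game_graph\<^esub> N"
    using N(2) flip[of b c a] flip[of a c b] flip[of a b c] by (auto simp: add_mset_commute)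
qed

section \<open>Heights, children and parents\<close>

lemma height_mset3: "fair a b c \<Longrightarrow> height {#a, b, c#} = 1 + (a + b + c)"
  by (simp add: height_def fair_def)

lemma fair_flips:
  assumes "fair a b c"
  shows "fair b c (2 * (b + c) + 1 - a)" "fair a c (2 * (a + c) + 1 - b)"
  using assms fair_flip fair_swap12 fair_swap23 by blast+

text \<open>Replacing an entry \<open>z\<close> beside \<open>x\<close> and \<open>y\<close> changes
  the height by \<open>2 * (x + y - z) + 1\<close>. Since \<open>a < b\<close> and
  \<open>a + b < c\<close>, this is positive for \<open>a\<close> and \<open>b\<close> and negative
  for \<open>c\<close>.\<close>

lemma children_mset3:
  assumes "fair a b c" "0 \<le> a" "a < b" "a + b < c"
  shows "children {#a, b, c#} = {{#b, c, 2 * (b + c) + 1 - a#}, {#a, c, 2 * (a + c) + 1 - b#}}"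
    (is "_ = {?A, ?B}")
proof -
  have M: "{#a, b, c#} \<in> nontrivial_games"
    using assms by (simp add: mset3_in_nontrivial_games)
  have AB: "?A \<in> nontrivial_games" "?B \<in> nontrivial_games"
    using assms fair_flips[OF assms(1)] by (simp_all add: mset3_in_nontrivial_games)
  show ?thesis
    unfolding children_def dominates_mset3_iff[OF M]
    using AB assms fair_flips[OF assms(1)] fair_flip[OF assms(1)]
    by (auto simp: height_mset3)
qed

lemma parents_mset3:
  assumes "fair a b c" "0 \<le> a" "a < b" "a + b < c"
  shows "parents {#a, b, c#} = {{#a, b, 2 * (a + b) + 1 - c#}} \<inter> nontrivial_games"
proof -
  have M: "{#a, b, c#} \<in> nontrivial_games"
    using assms by (simp add: mset3_in_nontrivial_games)
  show ?thesis
    unfolding parents_def dominates_mset3_iff[OF M]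
    using assms fair_flips[OF assms(1)] fair_flip[OF assms(1)]
    by (auto simp: height_mset3)
qed

lemma dominates_height_neq:
  assumes "M \<rightarrow>\<^bsub>nontrivial_game_graph\<^esub> N"
  shows "height M \<noteq> height N"
proof -
  obtain a b c d where "M = {#a, b, c#}" "N = {#a, b, d#}" "c \<noteq> d"
    using assms by (auto simp: dominates_iff adjacent_games_def)
  with assms show ?thesis
    by (auto simp: dominates_iff mset3_in_nontrivial_games height_mset3)
qed

lemma card_children:
  assumes "M \<in> nontrivial_games"
  shows "card (children M) = 2"
  using assms
proof (cases rule: nontrivial_games_cases)
  case (1 a b c)
  \<comment> \<open>The two children are told apart by their sums, which differ by
    \<open>4 * (b - a)\<close>.\<close>
  have "sum_mset {#b, c, 2 * (b + c) + 1 - a#} \<noteq> sum_mset {#a, c, 2 * (a + c) + 1 - b#}"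
    using 1 by simp
  then have "{#b, c, 2 * (b + c) + 1 - a#} \<noteq> {#a, c, 2 * (a + c) + 1 - b#}" by metis
  then show ?thesis unfolding 1(1) children_mset3[OF 1(2-)] by simp
qed

lemma card_parents:
  assumes "M \<in> nontrivial_games" "M \<noteq> {#0, 1, 3#}"
  shows "card (parents M) = 1"
  using assms(1)
proof (cases rule: nontrivial_games_cases)
  case (1 a b c)
  have f: "fair a b (2 * (a + b) + 1 - c)" using 1 fair_flip by blast
  \<comment> \<open>Since \<open>0 \<le> a < b\<close>, a sum below 2 forces the flipped triple to
    be 0, 1, 0. Then \<open>c = 3\<close>, the excluded root.\<close>
  have "2 \<le> a + b + (2 * (a + b) + 1 - c)"
  proof (rule ccontr)
    assume "\<not> ?thesis"
    then have "a = 0" "b = 1" "2 * (a + b) + 1 - c = 0" using f 1 by (auto simp: fair_def)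
    moreover from this have "c = 3" by simp
    ultimately show False using 1(1) assms(2) by simp
  qed
  then show ?thesis
    unfolding 1(1) parents_mset3[OF 1(2-)] using f by (simp add: mset3_in_nontrivial_games)
qed

lemma parents_root: "parents {#0, 1, 3#} = {}"
  by (subst parents_mset3) (simp_all add: fair_def mset3_in_nontrivial_games)

lemma root_in_nontrivial: "{#0, 1, 3#} \<in> nontrivial_games"
  by (simp add: mset3_in_nontrivial_games fair_def)

section \<open>Cycles and connectedness in symmetric digraphs\<close>

lemma (in pre_digraph) cas_nth:
  assumes "cas u p v" "Suc i < length p"
  shows "tail G (p ! Suc i) = head G (p ! i)"
  using assms
proof (induction p arbitrary: u i)
  case (Cons e p)
  then show ?case by (cases i; cases p) auto
qed simp

lemma (in pre_digraph) cas_last: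
  assumes "cas u p v" "p \<noteq> []"
  shows "head G (last p) = v"
  using assms
proof (induction p arbitrary: u)
  case (Cons e p)
  then show ?case by (cases p) auto
qed simp

text \<open>Cyclic indexing joins the last arc of a closed walk to its first, so that no position on
  a cycle is special.\<close>

lemma (in pre_digraph) closed_cas_nth:
  assumes "cas u p u" "i < length p"
  shows "tail G (p ! (Suc i mod length p)) = head G (p ! i)"
proof (cases "Suc i < length p")
  case True
  then show ?thesis using cas_nth assms(1) by simp
next
  case False
  then have i: "Suc i = length p" using assms(2) by simp
  then have p: "p \<noteq> []" by auto
  then have "tail G (p ! 0) = u" using assms(1) by (simp add: cas_simp hd_conv_nth)
  moreover have "head G (last p) = u"
    using assms(1) p by (rule cas_last)
  moreover have "last p = p ! i" using p by (simp add: last_conv_nth flip: i)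
  ultimately show ?thesis using i by simp
qed

lemma (in sym_digraph) cycle_length_less_3:
  fixes h :: "'a \<Rightarrow> 'c::linorder"
  assumes neq: "\<And>u v. u \<rightarrow> v \<Longrightarrow> h u \<noteq> h v"
    and uniq: "\<And>u v w. u \<rightarrow> v \<Longrightarrow> u \<rightarrow> w \<Longrightarrow> h v < h u \<Longrightarrow> h w < h u \<Longrightarrow> v = w"
    and "cycle p"
  shows "length p < 3"
proof (rule ccontr)
  assume n: "\<not> length p < 3"
  obtain u where u: "cas u p u" and arcs: "set p \<subseteq> arcs G" and
    dist: "distinct (tl (awalk_verts u p))"
    using \<open>cycle p\<close> by (auto simp: cycle_def awalk_def)
  \<comment> \<open>The vertices after the first are exactly the heads of the arcs, so arc positions
    index the vertices of the cycle without repetition.\<close>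
  have dist: "distinct (map (head G) p)"
  proof -
    have "p \<noteq> []" using n by auto
    then have "tl (awalk_verts u p) = map (head G) p" using awalk_verts_conv'[OF u] by simp
    with dist show ?thesis by simp
  qed
  let ?v = "\<lambda>i. head G (p ! i)" and ?n = "length p"
  have adj: "?v i \<rightarrow> ?v (Suc i mod ?n)" if "i < ?n" for i
  proof -
    have "p ! (Suc i mod ?n) \<in> arcs G" using that by (intro subsetD[OF arcs] nth_mem mod_less_divisor) auto
    then have "tail G (p ! (Suc i mod ?n)) \<rightarrow> ?v (Suc i mod ?n)" by (rule in_arcs_imp_in_arcs_ends)
    then show ?thesis using closed_cas_nth[OF u that] by simp
  qed
  have inj: "i = j" if "?v i = ?v j" "i < ?n" "j < ?n" for i j
    using nth_eq_iff_index_eq[OF dist, of i j] that by simp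
  define H where "H = (\<lambda>i. h (?v i)) ` {..<?n}"
  have "finite H" "H \<noteq> {}" using n by (auto simp: H_def lessThan_empty_iff)
  then have "Max H \<in> H" by (rule Max_in)
  then obtain i where i: "i < ?n" "h (?v i) = Max H" by (auto simp: H_def)
  have le: "h (?v j) \<le> h (?v i)" if "j < ?n" for j
    unfolding i(2) using \<open>finite H\<close> that by (intro Max_ge) (auto simp: H_def)
  \<comment> \<open>These are the cyclic successor and predecessor of the highest position;
    \<open>i = 0\<close> is separate because subtraction on naturals truncates.\<close>
  define j k where "j = Suc i mod ?n" and "k = (if i = 0 then ?n - 1 else i - 1)"
  \<comment> \<open>Here the length matters: on a cycle of length 1 or 2, successor and predecessor
    coincide.\<close>
  have jk: "j < ?n" "k < ?n" "Suc k mod ?n = i" "j \<noteq> k"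
    using i n by (auto simp: j_def k_def mod_Suc)
  have "?v i \<rightarrow> ?v j" using adj i by (simp add: j_def)
  moreover have "?v i \<rightarrow> ?v k" using adj[OF jk(2)] unfolding jk(3) by (rule graph_symmetric)
  \<comment> \<open>Maximality gives only a weak inequality; \<open>neq\<close> makes it strict
    along an edge.\<close>
  moreover have "h (?v l) < h (?v i)" if "l < ?n" "?v i \<rightarrow> ?v l" for l
    using le[OF that(1)] neq[OF that(2)] by (metis order.not_eq_order_implies_strict)
  ultimately have "?v j = ?v k" using uniq jk by blast
  then show False using inj jk by blast
qed

text \<open>Induction on \<open>h\<close> leads every vertex down to \<open>r\<close>; by symmetry
  these walks can be reversed, so any two vertices are joined through \<open>r\<close>.\<close>

lemma (in sym_digraph) connected_by_descent:
  fixes h :: "'a \<Rightarrow> nat"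
  assumes "r \<in> verts G"
    and descent: "\<And>u. u \<in> verts G \<Longrightarrow> u \<noteq> r \<Longrightarrow> \<exists>v. u \<rightarrow> v \<and> h v < h u"
  shows "connected G"
proof -
  have reach: "u \<rightarrow>\<^sup>* r" if "u \<in> verts G" for u
    using that
  proof (induction "h u" arbitrary: u rule: less_induct)
    case less
    show ?case
    proof (cases "u = r")
      case False
      then obtain v where v: "u \<rightarrow> v" "h v < h u" using descent less.prems by blast
      then have "v \<rightarrow>\<^sup>* r" using less.hyps by auto
      with v(1) show ?thesis by (rule adj_reachable_trans)
    qed (use assms(1) in simp)
  qed
  \<comment> \<open>\<open>connected\<close> refers to the symmetric closure, which adds no
    adjacency to a digraph that is already symmetric.\<close>
  have "arcs_ends (with_proj (mk_symmetric G)) = arcs_ends G"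
    by (auto simp: arcs_ends_conv mk_symmetric_def dest: graph_symmetric)
      (metis (no_types, lifting) arcs_ends_conv graph_symmetric image_iff prod.sel)+
  moreover have "u \<rightarrow>\<^sup>* v" if "u \<in> verts G" "v \<in> verts G" for u v
    using reach[OF that(1)] reach[OF that(2)] symmetric_reachable' reachable_trans by blast
  ultimately show ?thesis
    unfolding connected_def strongly_connected_def using assms(1) by (auto simp: reachable_def)
qed

section \<open>Infinitude and the tree property\<close>

lemma infinite_nontrivial: "infinite nontrivial_games"
proof
  assume fin: "finite nontrivial_games"
  then have "Max (height ` nontrivial_games) \<in> height ` nontrivial_games"
    using root_in_nontrivial by (intro Max_in) auto
  then obtain M where M: "M \<in> nontrivial_games" "height M = Max (height ` nontrivial_games)"
    by auto
  \<comment> \<open>A game of maximal height would still have a higher child.\<close>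
  have "children M \<noteq> {}" using card_children[OF M(1)] by auto
  then obtain N where "N \<in> nontrivial_games" "height M < height N"
    by (auto simp: children_def dominates_iff)
  then show False using M(2) fin by (simp add: leD)
qed

lemma undirected_tree_nontrivial: "undirected_tree nontrivial_game_graph"
proof -
  interpret sym_digraph nontrivial_game_graph by (rule sym_digraph_nontrivial)
  have "length p < 3" if "cycle p" for p
  proof (rule cycle_length_less_3[where h = height, OF dominates_height_neq _ that])
    fix M N N'
    assume *: "M \<rightarrow>\<^bsub>nontrivial_game_graph\<^esub> N" "M \<rightarrow>\<^bsub>nontrivial_game_graph\<^esub> N'"
      "height N < height M" "height N' < height M"
    then have "N \<in> parents M" "N' \<in> parents M" by (auto simp: parents_def)
    \<comment> \<open>The root is ruled out as \<open>M\<close>, since \<open>N\<close> is a parent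
      of \<open>M\<close> and the root has none.\<close>
    moreover have "card (parents M) = 1"
      using card_parents[of M] parents_root * by (auto simp: parents_def dominates_iff)
    ultimately show "N = N'" by (metis card_1_singletonE singletonD)
  qed
  moreover have "connected nontrivial_game_graph"
  \<comment> \<open>Descent needs a measure in the naturals; \<open>height\<close> is an absolute
    value, so \<open>nat\<close> preserves strict inequalities.\<close>
  proof (rule connected_by_descent[where r = "{#0, 1, 3#}" and h = "\<lambda>M. nat (height M)"])
    show "{#0, 1, 3#} \<in> verts nontrivial_game_graph"
      by (simp add: verts_nontrivial root_in_nontrivial)
    fix M assume "M \<in> verts nontrivial_game_graph" "M \<noteq> {#0, 1, 3#}"
    then have "parents M \<noteq> {}" using card_parents[of M] by (auto simp: verts_nontrivial)
    then show "\<exists>N. M \<rightarrow>\<^bsub>nontrivial_game_graph\<^esub> N \<and> nat (height N) < nat (height M)"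
      by (auto simp: parents_def height_def)
  qed
  ultimately show ?thesis unfolding undirected_tree_def by fastforce
qed

theorem theorem4p10:
  shows "infinite (verts nontrivial_game_graph)
    \<and> undirected_tree nontrivial_game_graph
    \<and> {#0, 1, 3#} \<in> verts nontrivial_game_graph
    \<and> (\<forall>M \<in> verts nontrivial_game_graph. card (children M) = 2)
    \<and> (\<forall>M \<in> verts nontrivial_game_graph. M \<noteq> {#0, 1, 3#} \<longrightarrow> card (parents M) = 1)
    \<and> parents {#0, 1, 3#} = {}"
  unfolding verts_nontrivial
  using infinite_nontrivial undirected_tree_nontrivial root_in_nontrivial card_children
    card_parents parents_root by blast

end
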